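(* Let $q,g\ge0$ be integers. The following conditions are equivalent: (i) $g\le\binom{q+1}{2}$; (ii) for all integers $W\ge0$ and $m\ge1$, $T_m(W)^2\ge T_{m-1}(W)\,T_{m+1}(W)$.
   Context: The integers $c_j$ are defined by $\sum_{j\ge0}c_jz^j=(1-z)^{-g}$ (so for $j\ge 0$, $c_j=\binom{g+j-1}{j}$ if $g\ge1$; if $g=0$, then $c_0=1$ and $c_j=0$ for $j>0$). For integers $W,m\ge0$, $T_m(W):=\sum_{r\ge0}\binom{q}{m-2r}c_{W+r}$, with the convention $\binom{q}{k}=0$ unless $0\le k\le q$. *)

theory Defs
  imports "HOL-Computational_Algebra.Formal_Power_Series"
begin

text \<open>
  The series \<open>1 / (1 - z) ^ g\<close> lives in the ring of integer power series, which is
  not of a sort with \<open>inverse\<close>; the second argument of \<open>fps_right_inverse\<close> is the inverse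
  of the constant term.  See \<open>c_generating_function\<close> and \<open>c_eq\<close>.
\<close>

definition c :: "nat \<Rightarrow> nat \<Rightarrow> int" where
  "c g j = fps_nth (fps_right_inverse ((1 - fps_X) ^ g) 1) j"

lemma c_generating_function: "Abs_fps (c g) * (1 - fps_X) ^ g = 1"
proof -
  have "Abs_fps (c g) = fps_right_inverse ((1 - fps_X) ^ g) 1"
    by (simp add: c_def fps_eq_iff)
  moreover have "(1 - fps_X) ^ g * fps_right_inverse ((1 - fps_X) ^ g) (1 :: int) = 1"
    by (rule fps_right_inverse) (simp add: fps_power_zeroth)
  ultimately show ?thesis
    by (simp add: mult.commute)
qed

lemma c_eq:
  "c g j = (if g = 0 then (if j = 0 then 1 else 0) else int ((g + j - 1) choose j))"
proof (induction g arbitrary: j)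
  case 0
  have "Abs_fps (c 0) = 1"
    using c_generating_function[of 0] by simp
  then have "fps_nth (Abs_fps (c 0)) j = fps_nth 1 j"
    by simp
  then show ?case by simp
next
  case (Suc g)
  have nz: "(1 - fps_X) ^ g \<noteq> (0 :: int fps)"
    using c_generating_function[of g] by auto
  have "(Abs_fps (c (Suc g)) * (1 - fps_X)) * (1 - fps_X) ^ g = Abs_fps (c g) * (1 - fps_X) ^ g"
    using c_generating_function[of "Suc g"] c_generating_function[of g]
    by (simp add: mult.assoc)
  then have rec: "Abs_fps (c (Suc g)) * (1 - fps_X) = Abs_fps (c g)"
    using nz by simp
  have step: "c (Suc g) i - (if i = 0 then 0 else c (Suc g) (i - 1)) = c g i" for i
    using arg_cong[OF rec, of "\<lambda>f. fps_nth f i"]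
    by (simp add: algebra_simps)
  have "c (Suc g) j = int ((g + j) choose j)"
  proof (induction j)
    case 0
    show ?case using step[of 0] Suc.IH[of 0] by (simp split: if_splits)
  next
    case (Suc i)
    have "c (Suc g) (Suc i) = int ((g + i) choose i) + c g (Suc i)"
      using step[of "Suc i"] Suc.IH by simp
    then show ?case
      using \<open>\<And>j. c g j = _\<close>[of "Suc i"] by simp
  qed
  then show ?case by simp
qed

text \<open>
  The range of \<open>r\<close> is cut to \<open>2 * r \<le> m\<close> because subtraction on \<^typ>\<open>nat\<close> truncates; the
  omitted binomial coefficients are those with a negative lower index.
\<close>

definition T :: "nat \<Rightarrow> nat \<Rightarrow> nat \<Rightarrow> nat \<Rightarrow> int" where
  "T q g m W = (\<Sum>r | 2 * r \<le> m. int (q choose (m - 2 * r)) * c g (W + r))"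

end

theory Submission
  imports Defs Complex_Main
begin

text \<open>
  Taking \<open>W = 0\<close>, \<open>m = 1\<close> in (ii) gives (i). For the converse fix \<open>N = m + 2 W\<close> and compare
  the defects \<open>gap W m = T_m(W)^2 - T_{m-1}(W) T_{m+1}(W)\<close> for all \<open>W\<close>. Since
  \<open>T_m(W) = binom(q,m) c_W + T_{m-2}(W+1)\<close>, the difference \<open>gap W m - gap (W+1) (m-2)\<close> is
  \<open>c_W\<close> times a linear form in \<open>c_W, c_{W+1}, \<dots>\<close>, a positive multiple of the sum \<open>\<Lambda>\<close> below.
  Along the chain \<open>N\<close> the sign of \<open>\<Lambda>\<close> changes at most once, from negative to positive as \<open>W\<close> grows.
  Hence the defect is at least one of its values at the two ends: it vanishes once \<open>W\<close> exceeds
  \<open>N / 2\<close>, and for \<open>W = 0\<close> it is nonnegative because \<open>(1 + t)^q / (1 - t^2)^g\<close> has coefficients with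
  a three-term recurrence.

  The argument is run for \<open>binom(q,2) < g \<le> binom(q+1,2)\<close>; smaller \<open>g\<close> follow since multiplying by
  \<open>1 + t\<close> preserves log-concavity.
\<close>

section \<open>Binomials and \<open>T\<close> with integer index and real values\<close>

text \<open>An integer lower index lets the shifts by one and two below avoid truncated subtraction;
  the absorption identities then hold for every \<open>k\<close>.\<close>

definition ibinom :: "nat \<Rightarrow> int \<Rightarrow> real" where
  "ibinom q k = (if k < 0 then 0 else real (q choose nat k))"

definition real_c :: "nat \<Rightarrow> nat \<Rightarrow> real" where
  "real_c g j = of_int (c g j)"

text \<open>The range up to \<open>nat n\<close> exceeds the support: summands with
  \<open>2 * r > n\<close> vanish, and for negative \<open>n\<close> the one summand left is zero
  too.\<close>

definition real_T :: "nat \<Rightarrow> nat \<Rightarrow> nat \<Rightarrow> int \<Rightarrow> real" where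
  "real_T q g W n = (\<Sum>r\<le>nat n. ibinom q (n - 2 * int r) * real_c g (W + r))"

definition gap :: "nat \<Rightarrow> nat \<Rightarrow> nat \<Rightarrow> int \<Rightarrow> real" where
  "gap q g W n = (real_T q g W n)\<^sup>2 - real_T q g W (n - 1) * real_T q g W (n + 1)"

lemma ibinom_neg: "k < 0 \<Longrightarrow> ibinom q k = 0"
  by (simp add: ibinom_def)

lemma ibinom_nonneg: "ibinom q k \<ge> 0"
  by (simp add: ibinom_def)

lemma ibinom_of_nat: "ibinom q (int k) = real (q choose k)"
  by (simp add: ibinom_def)

lemma ibinom_gt: "k > int q \<Longrightarrow> ibinom q k = 0"
  by (simp add: ibinom_def binomial_eq_0)

lemma ibinom_absorb: "of_int k * ibinom (Suc q) k = (real q + 1) * ibinom q (k - 1)"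
proof (cases "k \<le> 0")
  case True
  then show ?thesis by (cases "k = 0") (auto simp: ibinom_def)
next
  case False
  then obtain j where j: "k = int (Suc j)"
    by (metis gr0_conv_Suc linorder_not_le pos_int_cases)
  have "Suc j * (Suc q choose Suc j) = Suc q * (q choose j)"
    by (rule Suc_times_binomial)
  then have "real (Suc j * (Suc q choose Suc j)) = real (Suc q * (q choose j))"
    by presburger
  then have "real (Suc j) * ibinom (Suc q) (int (Suc j)) = real (Suc q) * ibinom q (int j)"
    by (simp only: ibinom_of_nat of_nat_mult)
  then show ?thesis by (simp add: j add.commute)
qed

lemma ibinom_pascal: "ibinom (Suc q) k = ibinom q k + ibinom q (k - 1)"
proof (cases "k \<le> 0")
  case True
  then show ?thesis by (cases "k = 0") (auto simp: ibinom_def)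
next
  case False
  then obtain j where j: "k = int (Suc j)"
    by (metis gr0_conv_Suc linorder_not_le pos_int_cases)
  have "ibinom (Suc q) (int (Suc j)) = ibinom q (int (Suc j)) + ibinom q (int j)"
    by (simp only: ibinom_of_nat binomial_Suc_Suc of_nat_add add.commute)
  then show ?thesis by (simp add: j)
qed

lemma ibinom_absorb_upper: "(real q + 1 - of_int k) * ibinom (Suc q) k = (real q + 1) * ibinom q k"
  using ibinom_absorb[of k q] by (simp add: ibinom_pascal algebra_simps)

lemma ibinom_rec: "(of_int k + 1) * ibinom q (k + 1) = (real q - of_int k) * ibinom q k"
proof -
  have "of_int (k + 1) * ibinom (Suc q) (k + 1) = (real q + 1) * ibinom q k"
    using ibinom_absorb[of "k + 1" q] by simp
  then show ?thesis by (simp add: ibinom_pascal algebra_simps)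
qed

lemma real_c_rec: "(real j + 1) * real_c g (Suc j) = (real g + real j) * real_c g j"
proof (cases g)
  case 0
  then show ?thesis by (simp add: real_c_def c_eq)
next
  case (Suc h)
  have "Suc j * ((h + Suc j) choose Suc j) = (h + Suc j) * ((h + j) choose j)"
    using binomial_absorption[of j "h + Suc j"] by simp
  then have "real (Suc j * ((h + Suc j) choose Suc j)) = real ((h + Suc j) * ((h + j) choose j))"
    by presburger
  then have "real (Suc j) * real ((h + Suc j) choose Suc j)
      = real (h + Suc j) * real ((h + j) choose j)"
    by (simp only: of_nat_mult)
  then show ?thesis
    by (simp add: real_c_def c_eq Suc algebra_simps)
qed

lemma real_c_nonneg: "real_c g j \<ge> 0"
  by (simp add: real_c_def c_eq)

lemma real_c_pos: "g \<ge> 1 \<Longrightarrow> real_c g j > 0"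
  by (auto simp: real_c_def c_eq)

text \<open>Zero padding lets sums with different \<open>n\<close> share one range.\<close>

lemma real_T_eq:
  assumes "nat n \<le> M"
  shows "real_T q g W n = (\<Sum>r\<le>M. ibinom q (n - 2 * int r) * real_c g (W + r))"
  unfolding real_T_def
proof (rule sum.mono_neutral_left)
  show "\<forall>i\<in>{..M} - {..nat n}. ibinom q (n - 2 * int i) * real_c g (W + i) = 0"
    by (auto simp: ibinom_neg)
qed (use assms in auto)

lemma real_T_neg: "n < 0 \<Longrightarrow> real_T q g W n = 0"
  by (simp add: real_T_def ibinom_neg)

text \<open>Splitting off \<open>r = 0\<close> keeps \<open>n + 2 * W\<close> fixed, so this is one
  step along a chain.\<close>

lemma real_T_shift: "real_T q g W n = ibinom q n * real_c g W + real_T q g (Suc W) (n - 2)"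
proof -
  have "real_T q g W n = (\<Sum>r\<le>Suc (nat n). ibinom q (n - 2 * int r) * real_c g (W + r))"
    by (rule real_T_eq) simp
  also have "\<dots> = ibinom q n * real_c g W
      + (\<Sum>r\<le>nat n. ibinom q (n - 2 - 2 * int r) * real_c g (Suc W + r))"
    by (subst sum.atMost_Suc_shift) (simp add: algebra_simps)
  also have "(\<Sum>r\<le>nat n. ibinom q (n - 2 - 2 * int r) * real_c g (Suc W + r)) = real_T q g (Suc W) (n - 2)"
    by (rule real_T_eq[symmetric]) simp
  finally show ?thesis .
qed

text \<open>On generating functions in \<open>n\<close> this is multiplication by 1 + t.\<close>

lemma real_T_pascal: "real_T (Suc q) g W n = real_T q g W n + real_T q g W (n - 1)"
proof -
  have "real_T (Suc q) g W n = (\<Sum>r\<le>nat n. ibinom (Suc q) (n - 2 * int r) * real_c g (W + r))"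
    by (simp add: real_T_def)
  also have "\<dots> = (\<Sum>r\<le>nat n. ibinom q (n - 2 * int r) * real_c g (W + r))
      + (\<Sum>r\<le>nat n. ibinom q (n - 1 - 2 * int r) * real_c g (W + r))"
    by (simp add: ibinom_pascal algebra_simps sum.distrib)
  also have "\<dots> = real_T q g W n + real_T q g W (n - 1)"
    by (subst (1 2) real_T_eq[where M = "nat n"]) auto
  finally show ?thesis .
qed

lemma real_T_of_nat: "real_T q g W (int m) = of_int (T q g m W)"
proof -
  have "T q g m W = (\<Sum>r\<in>{..m div 2}. int (q choose (m - 2 * r)) * c g (W + r))"
    unfolding T_def by (rule sum.cong) auto
  then have "of_int (T q g m W) = (\<Sum>r\<in>{..m div 2}. real (q choose (m - 2 * r)) * real_c g (W + r))"
    by (simp add: real_c_def)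
  also have "\<dots> = (\<Sum>r\<in>{..m div 2}. ibinom q (int m - 2 * int r) * real_c g (W + r))"
  proof (rule sum.cong)
    fix r assume "r \<in> {..m div 2}"
    then have "int m - 2 * int r = int (m - 2 * r)" by auto
    then show "real (q choose (m - 2 * r)) * real_c g (W + r) = ibinom q (int m - 2 * int r) * real_c g (W + r)"
      by (simp only: ibinom_of_nat)
  qed simp
  also have "\<dots> = (\<Sum>r\<le>m. ibinom q (int m - 2 * int r) * real_c g (W + r))"
    by (rule sum.mono_neutral_left) (auto simp: ibinom_neg)
  finally show ?thesis by (simp add: real_T_def)
qed

text \<open>The summand at half of \<open>n\<close>, rounded down, has lower index 0 or 1, where the
  binomial is positive for \<open>q \<ge> 1\<close>.\<close>

lemma real_T_pos:
  assumes "q \<ge> 1" "g \<ge> 1" "n \<ge> 0"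
  shows "real_T q g W n > 0"
  unfolding real_T_def
proof (rule sum_pos2[of _ "nat n div 2"])
  obtain j where j: "n = int j"
    using assms(3) nonneg_int_cases by blast
  have "n - 2 * int (nat n div 2) = n mod 2"
    unfolding j by (simp add: zdiv_int minus_mult_div_eq_mod)
  moreover have "n mod 2 = 0 \<or> n mod 2 = 1" by auto
  ultimately have "ibinom q (n - 2 * int (nat n div 2)) > 0"
    using assms(1) by (auto simp: ibinom_def)
  then show "ibinom q (n - 2 * int (nat n div 2)) * real_c g (W + nat n div 2) > 0"
    using real_c_pos[OF assms(2)] by simp
qed (auto intro!: mult_nonneg_nonneg ibinom_nonneg real_c_nonneg)

section \<open>Three-term recurrence and log-concavity at W = 0\<close>

text \<open>The series F = (1 + t)^q / (1 - t^2)^g satisfies (1 - t^2) F' = (q (1 - t) + 2 g t) F;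
  the recurrence compares coefficients of t^n. The proof works with the ratios of neighbouring
  binomials and of neighbouring \<open>real_c\<close> instead.\<close>

lemma real_T_rec0:
  "(of_int n + 1) * real_T q g 0 (n + 1)
    = real q * real_T q g 0 n + (2 * real g - real q + of_int n - 1) * real_T q g 0 (n - 1)"
proof -
  define M where "M = nat (n + 1)"
  define b where "b r = ibinom q (n + 1 - 2 * int r)" for r
  define b' where "b' r = ibinom q (n - 2 * int r)" for r
  define b'' where "b'' r = ibinom q (n - 1 - 2 * int r)" for r
  have bb: "(of_int n + 1 - 2 * real r) * b r = (real q - of_int n + 2 * real r) * b' r" for r
    using ibinom_rec[of "n - 2 * int r" q] by (simp add: b_def b'_def algebra_simps)
  have bb': "(of_int n - 2 * real r) * b' r = (real q - of_int n + 1 + 2 * real r) * b'' r" for r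
    using ibinom_rec[of "n - 1 - 2 * int r" q] by (simp add: b'_def b''_def algebra_simps)
  have S1: "real_T q g 0 (n + 1) = (\<Sum>r\<le>Suc M. b r * real_c g r)"
    and S2: "real_T q g 0 n = (\<Sum>r\<le>Suc M. b' r * real_c g r)"
    unfolding b_def b'_def using real_T_eq[of _ "Suc M" q g 0] by (auto simp: M_def)
  have S3: "real_T q g 0 (n - 1) = (\<Sum>r\<le>Suc M. b'' r * real_c g r)"
    unfolding b''_def using real_T_eq[of _ "Suc M" q g 0] by (auto simp: M_def)
  have z: "b'' (Suc M) = 0"
    unfolding b''_def M_def by (rule ibinom_neg) auto
  have bs: "b (Suc r) = b'' r" for r
    by (simp add: b_def b''_def algebra_simps)
  \<comment> \<open>Shifting the index turns the factor \<open>r\<close> into \<open>g + r\<close>;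
    this is how \<open>g\<close> enters the recurrence.\<close>
  have "(\<Sum>r\<le>Suc M. real r * real_c g r * b r)
      = (\<Sum>r\<le>M. (real r + 1) * real_c g (Suc r) * b (Suc r))"
    by (subst sum.atMost_Suc_shift) (simp add: add.commute)
  also have "\<dots> = (\<Sum>r\<le>M. (real g + real r) * real_c g r * b'' r)"
    by (simp only: real_c_rec bs)
  also have "\<dots> = (\<Sum>r\<le>Suc M. (real g + real r) * real_c g r * b'' r)"
    by (simp add: z)
  finally have sh: "(\<Sum>r\<le>Suc M. real r * real_c g r * b r)
      = (\<Sum>r\<le>Suc M. (real g + real r) * real_c g r * b'' r)" .
  have "(of_int n + 1) * b r * real_c g r = real q * b' r * real_c g r
      - (real q - of_int n + 1 + 2 * real r) * b'' r * real_c g r + 2 * (real r * real_c g r * b r)" for r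
  proof -
    have "(of_int n + 1) * b r = real q * b' r - (real q - of_int n + 1 + 2 * real r) * b'' r
        + 2 * real r * b r"
      using bb[of r] bb'[of r] by (simp add: algebra_simps)
    from arg_cong[OF this, of "\<lambda>z. z * real_c g r"] show ?thesis by (simp add: algebra_simps)
  qed
  then have "(of_int n + 1) * real_T q g 0 (n + 1) = (\<Sum>r\<le>Suc M. real q * b' r * real_c g r
      - (real q - of_int n + 1 + 2 * real r) * b'' r * real_c g r + 2 * (real r * real_c g r * b r))"
    by (simp only: S1 sum_distrib_left mult.assoc)
  also have "\<dots> = (\<Sum>r\<le>Suc M. real q * b' r * real_c g r)
      - (\<Sum>r\<le>Suc M. (real q - of_int n + 1 + 2 * real r) * b'' r * real_c g r)
      + 2 * (\<Sum>r\<le>Suc M. real r * real_c g r * b r)"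
    by (simp only: sum.distrib sum_subtractf sum_distrib_left)
  also have "\<dots> = (\<Sum>r\<le>Suc M. real q * (b' r * real_c g r)
      + (2 * real g - real q + of_int n - 1) * (b'' r * real_c g r))"
    unfolding sh sum_distrib_left sum_subtractf[symmetric] sum.distrib[symmetric]
    by (rule sum.cong) (simp_all add: algebra_simps)
  also have "\<dots> = real q * real_T q g 0 n + (2 * real g - real q + of_int n - 1) * real_T q g 0 (n - 1)"
    by (simp only: sum.distrib S2 S3 sum_distrib_left)
  finally show ?thesis .
qed

text \<open>
  Here \<open>a, b, c, d\<close> are consecutive coefficients and \<open>q^2 + q - 2 g = \<delta>\<close>. By the recurrence,
  \<open>ab\<close> says that the coefficient before \<open>a\<close> times \<open>b\<close> is at most \<open>a^2\<close>, so log-concavity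
  propagates by steps of two.
\<close>

lemma two_step_log_concave:
  fixes a b c d q m A \<delta> :: real
  assumes pos: "a > 0" "b > 0" "a \<le> q * b" and q: "q \<ge> 2" and m: "m \<ge> 1"
    and A: "A = q\<^sup>2 + m - 1 - \<delta>" "A \<ge> 0" and \<delta>: "0 \<le> \<delta>" "\<delta> \<le> q\<^sup>2 - 4"
    and ab: "m * b\<^sup>2 \<le> q * a * b + (A - 1) * a\<^sup>2"
    and c: "(m + 1) * c = q * b + A * a"
    and d: "(m + 2) * d = q * c + (A + 1) * b"
  shows "b * d \<le> c\<^sup>2"
proof -
  define \<kappa> where "\<kappa> = q\<^sup>2 - (A + 1) * (m + 1)\<^sup>2"
  define E where "E = b\<^sup>2 * \<kappa> + (m + 3) * q * A * (a * b) + (m + 2) * A\<^sup>2 * a\<^sup>2"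
  have "(m + 1)\<^sup>2 * (m + 2) * (c\<^sup>2 - b * d)
      = (m + 2) * ((m + 1) * c)\<^sup>2 - (m + 1)\<^sup>2 * b * ((m + 2) * d)"
    by algebra
  also have "\<dots> = (m + 2) * ((m + 1) * c)\<^sup>2 - (m + 1) * b * (q * ((m + 1) * c) + (m + 1) * (A + 1) * b)"
    unfolding d by algebra
  also have "\<dots> = E"
    unfolding c E_def \<kappa>_def by algebra
  finally have E: "(m + 1)\<^sup>2 * (m + 2) * (c\<^sup>2 - b * d) = E" .
  have "E \<ge> 0"
  proof (cases "\<kappa> \<ge> 0")
    case True
    then show ?thesis
      using pos q m A(2) by (simp add: E_def)
  next
    case False
    define X where "X = m * (q\<^sup>2 - 4) - \<delta> * (m - 1)"
    have "\<delta> * (m - 1) \<le> (q\<^sup>2 - 4) * (m - 1)"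
      using \<delta> m by (intro mult_right_mono) auto
    moreover have "q\<^sup>2 - 4 \<ge> 0" using \<delta> by linarith
    ultimately have X: "X \<ge> 0"
      by (simp add: X_def algebra_simps)
    \<comment> \<open>For negative \<open>\<kappa>\<close> the hypothesis \<open>ab\<close> bounds
      the \<open>b\<^sup>2\<close> term of \<open>E\<close> from below; what remains has the factor
      \<open>q * b - a\<close>, nonnegative by assumption.\<close>
    have "\<kappa> * (q * a * b + (A - 1) * a\<^sup>2) \<le> \<kappa> * (m * b\<^sup>2)"
      using False ab by (intro mult_left_mono_neg) auto
    then have "m * E \<ge> \<kappa> * (q * a * b + (A - 1) * a\<^sup>2)
        + m * ((m + 3) * q * A * (a * b) + (m + 2) * A\<^sup>2 * a\<^sup>2)"
      by (simp add: E_def algebra_simps)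
    moreover have "\<kappa> * (q * a * b + (A - 1) * a\<^sup>2)
        + m * ((m + 3) * q * A * (a * b) + (m + 2) * A\<^sup>2 * a\<^sup>2)
        = a * X * (q * b - a) + a\<^sup>2 * (\<delta> * (q\<^sup>2 + m - 1 - \<delta>))"
      unfolding \<kappa>_def X_def A(1) by algebra
    moreover have "a * X * (q * b - a) + a\<^sup>2 * (\<delta> * (q\<^sup>2 + m - 1 - \<delta>)) \<ge> 0"
      using pos X \<delta> A by simp
    ultimately have "m * E \<ge> 0" by linarith
    then show ?thesis
      using m by (simp add: zero_le_mult_iff)
  qed
  then have "0 \<le> (m + 1)\<^sup>2 * (m + 2) * (c\<^sup>2 - b * d)"
    by (simp only: E)
  moreover have "(m + 1)\<^sup>2 * (m + 2) > 0" using m by simp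
  ultimately have "c\<^sup>2 - b * d \<ge> 0"
    by (metis not_less zero_le_mult_iff)
  then show ?thesis by simp
qed

text \<open>The bound \<open>2 * g \<ge> q + 4\<close> is the condition
  \<open>\<delta> \<le> q\<^sup>2 - 4\<close> of \<open>two_step_log_concave\<close>.\<close>

lemma gap_W_0_nonneg:
  assumes q: "q \<ge> 2" and g: "2 * g \<le> q * (q + 1)" "2 * g \<ge> q + 4"
  shows "gap q g 0 (int m) \<ge> 0"
proof -
  define t where "t n = real_T q g 0 n" for n
  have t_pos: "t n > 0" if "n \<ge> 0" for n
    unfolding t_def using that q g by (intro real_T_pos) auto
  have rec: "(of_int n + 1) * t (n + 1)
      = real q * t n + (2 * real g - real q + of_int n - 1) * t (n - 1)" for n
    unfolding t_def by (rule real_T_rec0)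
  have g1: "2 * real g \<le> real q * (real q + 1)" "2 * real g \<ge> real q + 4"
    using g by (metis of_nat_1 of_nat_add of_nat_le_iff of_nat_mult of_nat_numeral,
      metis of_nat_add of_nat_le_iff of_nat_mult of_nat_numeral)
  have q3: "real q \<ge> 2" using q by simp
  have q2: "real q * real q \<ge> 2 * real q"
    using q by (intro mult_right_mono) auto
  have tm1: "t (- 1) = 0" by (simp add: t_def real_T_neg)
  have t0: "t 1 = real q * t 0"
    using rec[of 0] tm1 by simp
  have t1: "2 * t 2 = real q * t 1 + (2 * real g - real q) * t 0"
    using rec[of 1] by simp
  \<comment> \<open>Two consecutive inequalities are carried because the step goes from the first to
    the one after the second; the ratio bounds supply the hypothesis \<open>a \<le> q * b\<close> of
    \<open>two_step_log_concave\<close>.\<close>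
  have "t (int m) * t (int m) \<ge> t (int m - 1) * t (int m + 1)
      \<and> t (int m + 1) * t (int m + 1) \<ge> t (int m) * t (int m + 2)
      \<and> t (int m + 1) \<le> real q * t (int m) \<and> t (int m) \<le> real q * t (int m + 1)"
  proof (induction m)
    case 0
    have "2 * (t 0 * t 2) = t 0 * (real q * t 1 + (2 * real g - real q) * t 0)"
      by (simp add: t1[symmetric])
    also have "\<dots> = (real q * real q + 2 * real g - real q) * (t 0 * t 0)"
      by (simp add: t0 algebra_simps)
    \<comment> \<open>This is exactly \<open>2 * g \<le> q * (q + 1)\<close>.\<close>
    also have "\<dots> \<le> (2 * (real q * real q)) * (t 0 * t 0)"
      using g1 by (intro mult_right_mono) (auto simp: algebra_simps)
    also have "\<dots> = 2 * (t 1 * t 1)"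
      by (simp add: t0)
    finally have "t 1 * t 1 \<ge> t 0 * t 2" by simp
    moreover have "1 \<le> real q * real q"
      using q2 q3 by linarith
    then have "1 * t 0 \<le> (real q * real q) * t 0"
      using t_pos[of 0] by (intro mult_right_mono) auto
    ultimately show ?case by (simp add: tm1 t0 mult.assoc)
  next
    case (Suc m)
    define z where "z = t (int m)"
    define a where "a = t (int m + 1)"
    define b where "b = t (int m + 2)"
    define c where "c = t (int m + 3)"
    have pos: "z > 0" "a > 0" "b > 0" "c > 0"
      unfolding z_def a_def b_def c_def by (auto intro!: t_pos)
    have IH: "a * a \<ge> z * b" "a \<le> real q * z"
      using Suc.IH by (auto simp: a_def b_def z_def)
    have IH0: "t (int m) * t (int m) \<ge> t (int m - 1) * a" "z \<le> real q * a"
      using Suc.IH by (auto simp: a_def z_def)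
    have recb: "(real m + 2) * b = real q * a + (2 * real g - real q + real m) * z"
      using rec[of "int m + 1"] by (simp add: a_def b_def z_def algebra_simps)
    have recc: "(real m + 3) * c = real q * b + (2 * real g - real q + real m + 1) * a"
      using rec[of "int m + 2"] by (simp add: a_def b_def c_def algebra_simps)
    have reca: "(real m + 1) * a = real q * z + (2 * real g - real q + real m - 1) * t (int m - 1)"
      using rec[of "int m"] by (simp add: a_def z_def algebra_simps)
    \<comment> \<open>The recurrence for \<open>a\<close> turns log-concavity at \<open>z\<close>
      into an inequality between \<open>z\<close> and \<open>a\<close> alone, free of the
      coefficient before \<open>z\<close>.\<close>
    have "(real m + 1) * a\<^sup>2 = a * ((real m + 1) * a)"
      by (simp add: power2_eq_square)
    also have "\<dots> = real q * z * a + (2 * real g - real q + real m - 1) * (t (int m - 1) * a)"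
      unfolding reca by algebra
    also have "\<dots> \<le> real q * z * a + (2 * real g - real q + real m - 1) * (z * z)"
      using IH0 g1 by (intro add_left_mono mult_left_mono) (auto simp: z_def)
    finally have za: "(real m + 1) * a\<^sup>2
        \<le> real q * z * a + ((2 * real g - real q + real m) - 1) * z\<^sup>2"
      by (simp add: power2_eq_square)
    have "a * c \<le> b\<^sup>2"
    proof (rule two_step_log_concave[where a = z and m = "real m + 1" and q = "real q"
          and A = "2 * real g - real q + real m"
          and \<delta> = "real q * real q + real q - 2 * real g"])
      show "real q * real q + real q - 2 * real g \<le> (real q)\<^sup>2 - 4"
        using g1 by (simp add: power2_eq_square)
      show "(real m + 1 + 2) * c = real q * b + (2 * real g - real q + real m + 1) * a"
        using recc by (simp add: add_ac)
      show "(real m + 1 + 1) * b = real q * a + (2 * real g - real q + real m) * z"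
        using recb by (simp add: add_ac)
    qed (use pos IH0 g1 q za in \<open>auto simp: power2_eq_square algebra_simps\<close>)
    \<comment> \<open>By log-concavity the ratios of neighbours decrease, so the upper bound
      \<open>q\<close> persists.\<close>
    moreover have "z * b \<le> z * (real q * a)"
    proof -
      have "z * b \<le> a * a" by (rule IH)
      also have "\<dots> \<le> a * (real q * z)"
        using IH pos by (intro mult_left_mono) auto
      finally show ?thesis by (simp add: mult_ac)
    qed
    then have bq: "b \<le> real q * a"
      using pos by simp
    moreover have "a \<le> real q * b"
    proof -
      have "(real m + 2) * a \<le> (real q * real q + (2 * real g - real q + real m)) * a"
        by (rule mult_right_mono) (use q2 q3 g1 pos in linarith)+
      also have "\<dots> = real q * (real q * a) + (2 * real g - real q + real m) * a"
        by (simp add: algebra_simps)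
      also have "\<dots> \<le> real q * (real q * a) + (2 * real g - real q + real m) * (real q * z)"
        using IH g1 by (intro add_left_mono mult_left_mono) auto
      also have "\<dots> = real q * ((real m + 2) * b)"
        unfolding recb by algebra
      finally have "(real m + 2) * a \<le> (real m + 2) * (real q * b)"
        by (simp add: mult_ac)
      then show ?thesis by (simp add: mult_le_cancel_left)
    qed
    ultimately show ?case
      using IH by (simp add: a_def b_def c_def z_def power2_eq_square add_ac)
  qed
  then show ?thesis
    by (simp add: gap_def t_def power2_eq_square)
qed

section \<open>Passage from q to q + 1\<close>

text \<open>The difference of the two sides is the sum of the two given defects and
  \<open>u1 * u2 - u0 * u3\<close>; the last is nonnegative by multiplying the two inequalities and
  cancelling \<open>u1 * u2\<close>.\<close>

lemma log_concave_add_shift: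
  fixes u0 u1 u2 u3 :: real
  assumes "u0 \<ge> 0" "u1 > 0" "u2 > 0" "u3 \<ge> 0" "u0 * u2 \<le> u1\<^sup>2" "u1 * u3 \<le> u2\<^sup>2"
  shows "(u1 + u0) * (u3 + u2) \<le> (u2 + u1)\<^sup>2"
proof -
  have "(u0 * u2) * (u1 * u3) \<le> u1\<^sup>2 * u2\<^sup>2"
    using assms by (intro mult_mono) auto
  then have "(u1 * u2) * (u0 * u3) \<le> (u1 * u2) * (u1 * u2)"
    by (simp add: power2_eq_square mult_ac)
  then have "u0 * u3 \<le> u1 * u2"
    using assms by simp
  then show ?thesis
    using assms(5,6) by (simp add: power2_eq_square algebra_simps)
qed

lemma gap_nonneg_Suc:
  assumes "q \<ge> 1" "g \<ge> 1" and gap: "\<And>n. gap q g W n \<ge> 0"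
  shows "gap (Suc q) g W n \<ge> 0"
proof -
  consider "n < 0" | "n = 0" | "n \<ge> 1" by linarith
  then show ?thesis
  proof cases
    case 3
    then have "real_T q g W n > 0" "real_T q g W (n - 1) > 0" "real_T q g W (n + 1) > 0"
      using assms by (auto intro!: real_T_pos)
    moreover have "real_T q g W (n - 2) \<ge> 0"
      using real_T_pos[OF assms(1,2), of "n - 2" W] by (cases "n \<ge> 2") (auto simp: real_T_neg)
    ultimately have "(real_T q g W (n - 1) + real_T q g W (n - 2)) * (real_T q g W (n + 1) + real_T q g W n)
        \<le> (real_T q g W n + real_T q g W (n - 1))\<^sup>2"
      using gap[of n] gap[of "n - 1"]
      by (intro log_concave_add_shift) (auto simp: gap_def algebra_simps)
    then show ?thesis
      by (simp add: gap_def real_T_pascal)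
  qed (auto simp: gap_def real_T_neg)
qed

section \<open>The difference of neighbouring defects as a linear form\<close>

text \<open>
  With \<open>u = m + 1\<close>, \<open>v = u - 2 s\<close> and \<open>R = q + 2\<close>, the coefficient of \<open>c_{W+s}\<close> in the linear form
  is \<open>binom(R,u) binom(R,v) \<phi>(u,v)\<close> up to a constant, with half of this value for \<open>s = 0\<close>.
\<close>

definition \<phi> :: "nat \<Rightarrow> int \<Rightarrow> int \<Rightarrow> real" where
  "\<phi> R u v = of_int (int R * (u + v) - 2 * u * v - int R * (u - v)\<^sup>2)"

text \<open>The common factor \<open>ibinom R u\<close> of the linear form is divided out. The first
  term is half of \<open>\<phi> R u u\<close>; the sum index starts at 0 for the coefficient of
  \<open>real_c g (Suc W)\<close>.\<close>

definition \<Lambda> :: "nat \<Rightarrow> nat \<Rightarrow> nat \<Rightarrow> int \<Rightarrow> real" where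
  "\<Lambda> R g W u = of_int (u * (int R - u)) * ibinom R u * real_c g W
    + (\<Sum>s\<le>nat u. \<phi> R u (u - 2 - 2 * int s) * ibinom R (u - 2 - 2 * int s) * real_c g (Suc W + s))"

lemma \<Lambda>_eq:
  assumes "nat u \<le> M"
  shows "\<Lambda> R g W u = of_int (u * (int R - u)) * ibinom R u * real_c g W
    + (\<Sum>s\<le>M. \<phi> R u (u - 2 - 2 * int s) * ibinom R (u - 2 - 2 * int s) * real_c g (Suc W + s))"
proof -
  have "(\<Sum>s\<le>nat u. \<phi> R u (u - 2 - 2 * int s) * ibinom R (u - 2 - 2 * int s) * real_c g (Suc W + s))
    = (\<Sum>s\<le>M. \<phi> R u (u - 2 - 2 * int s) * ibinom R (u - 2 - 2 * int s) * real_c g (Suc W + s))"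
    by (rule sum.mono_neutral_left) (use assms in \<open>auto simp: ibinom_neg\<close>)
  then show ?thesis by (simp add: \<Lambda>_def)
qed

text \<open>Three neighbouring binomials of row \<open>q\<close> become polynomial multiples of one
  binomial of row \<open>q + 2\<close>, so products of them can be compared.\<close>

lemma ibinom_two_steps:
  fixes q :: nat and k :: int
  defines "R \<equiv> real q + 2"
  shows "of_int k * (of_int k - 1) * ibinom (q + 2) k = R * (R - 1) * ibinom q (k - 2)"
    and "of_int k * (R - of_int k) * ibinom (q + 2) k = R * (R - 1) * ibinom q (k - 1)"
    and "(R - of_int k) * (R - of_int k - 1) * ibinom (q + 2) k = R * (R - 1) * ibinom q k"
proof -
  have 1: "of_int k * ibinom (q + 2) k = R * ibinom (Suc q) (k - 1)"
    using ibinom_absorb[of k "Suc q"] by (simp add: R_def numeral_2_eq_2 add_ac)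
  have 2: "(R - of_int k) * ibinom (q + 2) k = R * ibinom (Suc q) k"
    using ibinom_absorb_upper[of "Suc q" k] by (simp add: R_def numeral_2_eq_2 add_ac)
  have 3: "(of_int k - 1) * ibinom (Suc q) (k - 1) = (R - 1) * ibinom q (k - 2)"
    using ibinom_absorb[of "k - 1" q] by (simp add: R_def)
  have 4: "(R - of_int k) * ibinom (Suc q) (k - 1) = (R - 1) * ibinom q (k - 1)"
    using ibinom_absorb_upper[of q "k - 1"] by (simp add: R_def algebra_simps)
  have 5: "(R - of_int k - 1) * ibinom (Suc q) k = (R - 1) * ibinom q k"
    using ibinom_absorb_upper[of q k] by (simp add: R_def algebra_simps)
  show "of_int k * (of_int k - 1) * ibinom (q + 2) k = R * (R - 1) * ibinom q (k - 2)"
    using 1 3 by algebra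
  show "of_int k * (R - of_int k) * ibinom (q + 2) k = R * (R - 1) * ibinom q (k - 1)"
    using 1 4 by algebra
  show "(R - of_int k) * (R - of_int k - 1) * ibinom (q + 2) k = R * (R - 1) * ibinom q k"
    using 2 5 by algebra
qed

text \<open>After multiplication by a further \<open>R - 1\<close>, every product on the left is
  covered by \<open>ibinom_two_steps\<close>; the resulting polynomial is divisible by
  \<open>R - 1\<close>, which is cancelled.\<close>

lemma \<phi>_kernel:
  fixes q :: nat and u v :: int
  defines "R \<equiv> real q + 2"
  shows "R\<^sup>2 * (R - 1) * (2 * ibinom q (u - 1) * ibinom q (v - 1) - ibinom q (u - 2) * ibinom q v
      - ibinom q u * ibinom q (v - 2)) = ibinom (q + 2) u * ibinom (q + 2) v * \<phi> (q + 2) u v"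
proof -
  define x y where "x = real_of_int u" and "y = real_of_int v"
  define bu bv where "bu = ibinom (q + 2) u" and "bv = ibinom (q + 2) v"
  note U = ibinom_two_steps[where q = q and k = u, folded R_def x_def bu_def]
  note V = ibinom_two_steps[where q = q and k = v, folded R_def y_def bv_def]
  have \<phi>: "\<phi> (q + 2) u v = R * (x + y) - 2 * x * y - R * (x - y)\<^sup>2"
    by (simp add: \<phi>_def R_def x_def y_def algebra_simps)
  have "(R - 1) * (R\<^sup>2 * (R - 1) * (2 * ibinom q (u - 1) * ibinom q (v - 1) - ibinom q (u - 2) * ibinom q v
      - ibinom q u * ibinom q (v - 2)))
    = 2 * (R * (R - 1) * ibinom q (u - 1)) * (R * (R - 1) * ibinom q (v - 1))
      - (R * (R - 1) * ibinom q (u - 2)) * (R * (R - 1) * ibinom q v)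
      - (R * (R - 1) * ibinom q u) * (R * (R - 1) * ibinom q (v - 2))"
    by algebra
  also have "\<dots> = (R - 1) * (bu * bv * \<phi> (q + 2) u v)"
    unfolding U[symmetric] V[symmetric] \<phi> by algebra
  finally show ?thesis
    by (simp add: R_def bu_def bv_def)
qed

text \<open>Inserting \<open>real_T_shift\<close> into the defect at \<open>W\<close>, the terms
  without \<open>real_c g W\<close> form exactly the defect at \<open>Suc W\<close>. The rest is
  \<open>real_c g W\<close> times the linear form \<open>L\<close>.\<close>

lemma gap_diff:
  fixes q g W :: nat and n :: int
  defines "R \<equiv> real q + 2"
  shows "R\<^sup>2 * (R - 1) * (gap q g W n - gap q g (Suc W) (n - 2))
    = real_c g W * ibinom (q + 2) (n + 1) * \<Lambda> (q + 2) g W (n + 1)"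
proof -
  define M where "M = nat (n + 1)"
  define S' where "S' = real_T q g (Suc W)"
  define L where "L = real_c g W * ((ibinom q n)\<^sup>2 - ibinom q (n - 1) * ibinom q (n + 1))
    + (2 * ibinom q n * S' (n - 2) - ibinom q (n - 1) * S' (n - 1) - ibinom q (n + 1) * S' (n - 3))"
  have "gap q g W n - gap q g (Suc W) (n - 2) = real_c g W * L"
  proof -
    have "real_T q g W n = ibinom q n * real_c g W + S' (n - 2)"
      "real_T q g W (n - 1) = ibinom q (n - 1) * real_c g W + S' (n - 3)"
      "real_T q g W (n + 1) = ibinom q (n + 1) * real_c g W + S' (n - 1)"
      by (subst real_T_shift, simp add: S'_def)+
    moreover have "gap q g (Suc W) (n - 2) = (S' (n - 2))\<^sup>2 - S' (n - 3) * S' (n - 1)"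
      by (simp add: gap_def S'_def)
    ultimately show ?thesis
      unfolding gap_def L_def by algebra
  qed
  moreover have "R\<^sup>2 * (R - 1) * L = ibinom (q + 2) (n + 1) * \<Lambda> (q + 2) g W (n + 1)"
  proof -
    \<comment> \<open>\<open>k (n - 1 - 2 * s)\<close> is the coefficient of
      \<open>real_c g (Suc W + s)\<close> in \<open>L\<close>, and \<open>k (n + 1)\<close> is twice
      that of \<open>real_c g W\<close>.\<close>
    define k where "k v = 2 * ibinom q n * ibinom q (v - 1) - ibinom q (n - 1) * ibinom q v
      - ibinom q (n + 1) * ibinom q (v - 2)" for v
    have k: "R\<^sup>2 * (R - 1) * k v = ibinom (q + 2) (n + 1) * (\<phi> (q + 2) (n + 1) v * ibinom (q + 2) v)" for v
      using \<phi>_kernel[of q "n + 1" v] by (simp add: k_def R_def mult_ac)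
    have "S' (n - 2) = (\<Sum>s\<le>M. ibinom q (n - 2 - 2 * int s) * real_c g (Suc W + s))"
      "S' (n - 1) = (\<Sum>s\<le>M. ibinom q (n - 1 - 2 * int s) * real_c g (Suc W + s))"
      "S' (n - 3) = (\<Sum>s\<le>M. ibinom q (n - 3 - 2 * int s) * real_c g (Suc W + s))"
      unfolding S'_def by (rule real_T_eq, simp add: M_def)+
    then have "2 * ibinom q n * S' (n - 2) - ibinom q (n - 1) * S' (n - 1) - ibinom q (n + 1) * S' (n - 3)
      = (\<Sum>s\<le>M. k (n - 1 - 2 * int s) * real_c g (Suc W + s))"
      by (simp add: k_def sum_distrib_left sum_subtractf[symmetric] algebra_simps)
    moreover have "2 * ((ibinom q n)\<^sup>2 - ibinom q (n - 1) * ibinom q (n + 1)) = k (n + 1)"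
      by (simp add: k_def power2_eq_square algebra_simps)
    ultimately have "R\<^sup>2 * (R - 1) * L = (R\<^sup>2 * (R - 1) * k (n + 1)) / 2 * real_c g W
      + (\<Sum>s\<le>M. (R\<^sup>2 * (R - 1) * k (n - 1 - 2 * int s)) * real_c g (Suc W + s))"
      unfolding L_def by (simp add: distrib_left sum_distrib_left mult_ac flip: \<open>_ = k (n + 1)\<close>)
    also have "\<dots> = ibinom (q + 2) (n + 1) * (\<phi> (q + 2) (n + 1) (n + 1) / 2 * ibinom (q + 2) (n + 1) * real_c g W
      + (\<Sum>s\<le>M. \<phi> (q + 2) (n + 1) (n - 1 - 2 * int s) * ibinom (q + 2) (n - 1 - 2 * int s)
          * real_c g (Suc W + s)))"
      unfolding k by (simp add: distrib_left sum_distrib_left mult_ac)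
    also have "\<phi> (q + 2) (n + 1) (n + 1) / 2 = of_int ((n + 1) * (int (q + 2) - (n + 1)))"
      by (simp add: \<phi>_def field_simps power2_eq_square)
    finally show ?thesis
      by (simp add: \<Lambda>_def M_def)
  qed
  ultimately show ?thesis
    by (simp add: mult_ac)
qed

section \<open>Polynomial inequalities and signs of single summands\<close>

text \<open>
  The polynomial inequalities below hold because all coefficients are nonnegative after the
  substitution by slack variables.
\<close>

lemma crossing_poly_nonneg_1:
  fixes R w s :: real
  assumes "1 \<le> s" "2 * s \<le> w" "2 * w + 1 \<le> R"
  shows "(R - w) * (4 * w - 2 - 4 * s + 4 * (s - 1/2) * (R - 1))
           - (w - 1) * (R - 2 * w + 2 * R * s) \<ge> 0"
proof -
  define s' e d where "s' = s - 1" and "e = w - 2 * s" and "d = R - 2 * w - 1"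
  have eq: "s = 1 + s'" "w = 2 + 2 * s' + e" "R = 5 + 4 * s' + 2 * e + d"
    by (simp_all add: s'_def e_def d_def)
  have "s' \<ge> 0" "e \<ge> 0" "d \<ge> 0"
    using assms by (simp_all add: s'_def e_def d_def)
  then show ?thesis
    unfolding eq by (simp add: algebra_simps)
qed

lemma crossing_poly_nonneg_2:
  fixes R w s g :: real
  assumes "1 \<le> s" "2 * s \<le> w" "2 * w + 1 \<le> R" "R - 1 \<le> g"
  shows "((R - w) * (4 * w - 2 - 4 * s + 4 * (s - 1/2) * (R - 1))
           - (w - 1) * (R - 2 * w + 2 * R * s)) * g * (R - w - 1)
         - 4 * g * ((R - 1) * (R - 2 * w)) * (s - 1/2) * (R - w + s - 1/2)
         + ((R - 1) * (R - 2 * w)) * ((s - 1/2) * ((R - 1) * (R - 2 * w) + 4 * (R - 1) * s)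
           - (w - 2 * s) * (w - 2 * s - 1)) \<ge> 0"
    (is "?F \<ge> 0")
proof -
  define s' e d where "s' = s - 1" and "e = w - 2 * s" and "d = R - 2 * w - 1"
  have eq: "s = 1 + s'" "w = 2 + 2 * s' + e" "R = 5 + 4 * s' + 2 * e + d"
    by (simp_all add: s'_def e_def d_def)
  have nonneg: "s' \<ge> 0" "e \<ge> 0" "d \<ge> 0"
    using assms by (simp_all add: s'_def e_def d_def)
  \<comment> \<open>The expression is affine in \<open>g\<close> with slope \<open>C\<close>; it is
    expanded about the smallest admissible value \<open>g = R - 1\<close>.\<close>
  define C where "C = ((R - w) * (4 * w - 2 - 4 * s + 4 * (s - 1/2) * (R - 1))
      - (w - 1) * (R - 2 * w + 2 * R * s)) * (R - w - 1)
    - 4 * ((R - 1) * (R - 2 * w)) * (s - 1/2) * (R - w + s - 1/2)"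
  define p where "p = (s - 1/2) * ((R - 1) * (R - 2 * w) + 4 * (R - 1) * s)
    - (w - 2 * s) * (w - 2 * s - 1)"
  have "C \<ge> 0"
    unfolding C_def eq using nonneg by (simp add: algebra_simps)
  moreover have "C + (R - 2 * w) * p \<ge> 0"
    unfolding C_def p_def eq using nonneg by (simp add: algebra_simps)
  ultimately have "(g - (R - 1)) * C + (R - 1) * (C + (R - 2 * w) * p) \<ge> 0"
    using assms by simp
  also have "(g - (R - 1)) * C + (R - 1) * (C + (R - 2 * w) * p) = ?F"
    unfolding C_def p_def by algebra
  finally show ?thesis .
qed

lemma crossing_poly_le_1:
  fixes R w :: real
  assumes "w + 2 \<le> R" "R \<le> 2 * w"
  shows "(w\<^sup>2 - 1) * (8 * (R - 1) * w + 4 * R + 8 * w)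
    - 4 * w * (R - 1) * (2 * w * (R - w) - w + 1) \<ge> 0"
proof -
  define f d where "f = R - w - 2" and "d = 2 * w - R"
  have eq: "w = 2 + f + d" "R = 4 + 2 * f + d"
    by (simp_all add: f_def d_def)
  have "f \<ge> 0" "d \<ge> 0"
    using assms by (simp_all add: f_def d_def)
  then show ?thesis
    unfolding eq
    by (simp add: algebra_simps power2_eq_square)
qed

lemma crossing_poly_le_2:
  fixes R w g :: real
  assumes "2 \<le> w" "2 * w + 1 \<le> R" "(R - 2) * (R - 3) + 2 \<le> g"
  shows "((w\<^sup>2 - 1) * (8 * (R - 1) * w + 4 * R + 8 * w)
    - 4 * w * (R - 1) * (2 * w * (R - w) - w + 1)) * g * (R - w) * (R - w - 1)
    + (2 * w * (R - w) - w + 1) * w * (g * (4 * R - 4 * w + 2) - 2 * (R - 1) * (R - 2 * w + 4))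
      * ((R - 1) * (R - 2 * w)) \<ge> 0"
    (is "?F \<ge> 0")
proof -
  define e d where "e = w - 2" and "d = R - 2 * w - 1"
  have eq: "w = 2 + e" "R = 5 + 2 * e + d"
    by (simp_all add: e_def d_def)
  have nonneg: "e \<ge> 0" "d \<ge> 0"
    using assms by (simp_all add: e_def d_def)
  define E where "E = 2 * w * (R - w) - w + 1"
  define K where "K = E * w * ((R - 1) * (R - 2 * w))"
  \<comment> \<open>The expression is \<open>g * C - 2 * (R - 1) * (R - 2 * w + 4) * K\<close>.
    Moving \<open>5 * K\<close> out of \<open>C\<close> leaves both parts nonnegative, since
    \<open>5 * g\<close> dominates \<open>2 * (R - 1) * (R - 2 * w + 4)\<close>.\<close>
  define C where "C = ((w\<^sup>2 - 1) * (8 * (R - 1) * w + 4 * R + 8 * w) - 4 * w * (R - 1) * E)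
      * (R - w) * (R - w - 1) + (4 * R - 4 * w + 2) * K"
  have "C - 5 * K \<ge> 0"
    unfolding C_def K_def E_def eq using nonneg by (simp add: algebra_simps power2_eq_square)
  moreover have "g \<ge> 0"
  proof -
    have "(R - 2) * (R - 3) \<ge> 0" using assms by simp
    then show ?thesis using assms(3) by linarith
  qed
  moreover have "E \<ge> 0"
    unfolding E_def eq using nonneg by (simp add: algebra_simps)
  then have "K \<ge> 0" unfolding K_def using assms by simp
  moreover have "5 * g - 2 * (R - 1) * (R - 2 * w + 4) \<ge> 0"
  proof -
    have "2 * (R - 1) * (R - 2 * w + 4) \<le> 5 * ((R - 2) * (R - 3) + 2)"
      unfolding eq using nonneg by (simp add: algebra_simps)
    also have "\<dots> \<le> 5 * g"
      using assms(3) by (rule mult_left_mono) simp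
    finally show ?thesis by simp
  qed
  ultimately have "g * (C - 5 * K) + K * (5 * g - 2 * (R - 1) * (R - 2 * w + 4)) \<ge> 0"
    by simp
  also have "g * (C - 5 * K) + K * (5 * g - 2 * (R - 1) * (R - 2 * w + 4)) = ?F"
    unfolding C_def K_def E_def by algebra
  finally show ?thesis .
qed

text \<open>Sign of one summand when \<open>\<sigma> 0\<close> is nonnegative in
  \<open>\<Lambda>_crossing\<close>, with \<open>k = W + 1\<close>. The hypothesis
  \<open>\<sigma>0\<close> forces \<open>2 * w < R\<close>, and its slack eliminates
  \<open>k\<close> up to nonnegative terms.\<close>

lemma crossing_term_nonneg:
  fixes R w s g k :: real
  assumes s: "1 \<le> s" "2 * s \<le> w" and R: "w \<le> R" and g: "R - 1 \<le> g" and k: "0 \<le> k"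
    and \<sigma>0: "(R - 1) * (R - 2 * w) * k \<ge> g * w * (w - 1)"
    and R1: "2 * w < R \<Longrightarrow> 2 * w + 1 \<le> R"
  defines "v \<equiv> w - 2 * s"
  shows "(w - 1) * (g + k) * (w * (R - w) - s * (R - 2 * w) - 2 * R * s\<^sup>2)
    + (R - w) * ((s - 1/2) * ((R - v) * (R - v - 1) * (k + s) - v * (v - 1) * (g + k + s))
                 - v * (v - 1) * (g + k + s)) \<ge> 0"
proof -
  have w: "w \<ge> 2" using s by simp
  have g0: "g > 0" using g R w by linarith
  have Rw: "2 * w < R"
  proof (rule ccontr)
    assume "\<not> 2 * w < R"
    then have "(R - 1) * (R - 2 * w) * k \<le> 0"
      using w R k by (simp add: mult_le_0_iff zero_le_mult_iff)
    moreover have "g * w * (w - 1) > 0" using g0 w by simp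
    ultimately show False using \<sigma>0 by linarith
  qed
  note R1 = R1[OF Rw]
  define \<Delta> where "\<Delta> = (R - 1) * (R - 2 * w)"
  have \<Delta>: "\<Delta> > 0" using Rw w by (simp add: \<Delta>_def)
  define H where "H = g + k"
  define x where "x = \<Delta> * k - g * w * (w - 1)"
  have x: "x \<ge> 0" using \<sigma>0 by (simp add: x_def \<Delta>_def)
  define h where "h = (R - w) * (4 * w - 2 - 4 * s + 4 * (s - 1/2) * (R - 1))
    - (w - 1) * (R - 2 * w + 2 * R * s)"
  have h: "h \<ge> 0"
    unfolding h_def using s R1 by (rule crossing_poly_nonneg_1)
  define p where "p = (s - 1/2) * ((R - 1) * (R - 2 * w) + 4 * (R - 1) * s)
    - (w - 2 * s) * (w - 2 * s - 1)"
  define G where "G = h * g * (R - w - 1) - 4 * g * \<Delta> * (s - 1/2) * (R - w + s - 1/2) + \<Delta> * p"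
  have G: "G \<ge> 0"
    unfolding G_def h_def \<Delta>_def p_def using s R1 g by (rule crossing_poly_nonneg_2)
  \<comment> \<open>The claim is \<open>s * F\<close> plus a nonnegative multiple of
    \<open>x\<close>. Multiplying \<open>F\<close> by \<open>\<Delta>\<close> allows
    \<open>H\<close> to be replaced by a polynomial in \<open>g\<close>, \<open>R\<close>,
    \<open>w\<close> plus \<open>x\<close>.\<close>
  define F where "F = h * H - 4 * g * (R - w) * (s - 1/2) * (R - w + s - 1/2) + (R - w) * p
    + (R - w) * (x / 2)"
  have "\<Delta> * H = g * (R - w) * (R - w - 1) + x"
    unfolding H_def x_def \<Delta>_def by algebra
  then have "\<Delta> * F = (R - w) * G + (h + (R - w) * (\<Delta> / 2)) * x"
    unfolding F_def G_def by algebra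
  moreover have "(R - w) * G + (h + (R - w) * (\<Delta> / 2)) * x \<ge> 0"
    using G R h \<Delta> x by simp
  ultimately have "F \<ge> 0"
    using \<Delta> by (metis not_less mult_pos_neg)
  then have "s * F + (R - w) * ((s - 1) / 2) * x \<ge> 0"
    using s R x by simp
  also have "s * F + (R - w) * ((s - 1) / 2) * x
    = (w - 1) * (g + k) * (w * (R - w) - s * (R - 2 * w) - 2 * R * s\<^sup>2)
    + (R - w) * ((s - 1/2) * ((R - v) * (R - v - 1) * (k + s) - v * (v - 1) * (g + k + s))
                 - v * (v - 1) * (g + k + s))"
    unfolding F_def p_def h_def x_def H_def \<Delta>_def v_def
    by (simp add: field_simps power2_eq_square)
  finally show ?thesis .
qed

text \<open>Sign of one summand when \<open>\<sigma> 0\<close> is negative in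
  \<open>\<Lambda>_crossing\<close>. Both factors on the left are replaced by simpler upper bounds,
  after which \<open>s\<close> cancels and \<open>key\<close> remains.\<close>

lemma crossing_term_le:
  fixes R w s g k :: real
  assumes s: "1 \<le> s" "2 * s \<le> w" and R: "w + 2 \<le> R" and g: "R - 1 \<le> g" and k: "1 \<le> k"
    and g2: "(R - 2) * (R - 3) + 2 \<le> 2 * g"
    and \<sigma>0: "(R - 1) * (R - 2 * w) * k \<le> g * w * (w - 1)"
    and R1: "2 * w < R \<Longrightarrow> 2 * w + 1 \<le> R"
  defines "v \<equiv> w - 2 * s"
  shows "((R - w - 2) / ((w + 1) * (g + k - 1)) + (R - w) / ((w - 1) * (g + k)))
      * ((R - v) * (R - v - 1) * (k + s) - v * (v - 1) * (g + k + s))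
    \<le> 2 * R + 4 * w + 8 * (R - 1) * s"
proof -
  have w: "w \<ge> 2" using s by simp
  define H where "H = g + k"
  have H: "H \<ge> R" "H > 1" "H > 0" using g k R w by (auto simp: H_def)
  define E where "E = 2 * w * (R - w) - w + 1"
  have "2 * w * (R - w) \<ge> w * 1" using w R by (simp add: mult_mono)
  then have E: "E \<ge> 0" by (simp add: E_def)
  define \<sigma> where "\<sigma> = (R - v) * (R - v - 1) * (k + s) - v * (v - 1) * (g + k + s)"
  \<comment> \<open>As a polynomial in \<open>s\<close>, \<open>\<sigma>\<close> is its value at 0,
    which is at most 0 by \<open>\<sigma>0\<close>, plus \<open>s * l\<close> minus a nonnegative
    multiple of \<open>s * (s - 1)\<close>.\<close>
  define l where "l = (R - 1) * (R - 2 * w + 4 * k + 4) + g * (4 * w - 6)"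
  have "\<sigma> = ((R - 1) * (R - 2 * w) * k - g * w * (w - 1)) + s * l - 4 * (g - R + 1) * (s * (s - 1))"
    unfolding \<sigma>_def l_def v_def by algebra
  moreover have "4 * (g - R + 1) * (s * (s - 1)) \<ge> 0" using g s by simp
  ultimately have \<sigma>: "\<sigma> \<le> s * l" using \<sigma>0 by linarith
  define B where "B = (R - w - 2) / ((w + 1) * (H - 1)) + (R - w) / ((w - 1) * H)"
  have B0: "B \<ge> 0"
    unfolding B_def using R w H by (intro add_nonneg_nonneg divide_nonneg_nonneg) auto
  \<comment> \<open>The denominator \<open>H - 1\<close> is traded for \<open>H\<close> at the cost
    of one in the numerator.\<close>
  have "(R - w - 2) * H \<le> (R - w - 1) * (H - 1)"
    using H w by (simp add: algebra_simps)
  then have "(R - w - 2) / (H - 1) \<le> (R - w - 1) / H"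
    using H by (simp add: divide_simps)
  then have "(R - w - 2) / (H - 1) / (w + 1) \<le> (R - w - 1) / H / (w + 1)"
    using w by (intro divide_right_mono) auto
  then have "B \<le> (R - w - 1) / H / (w + 1) + (R - w) / ((w - 1) * H)"
    by (simp add: B_def mult.commute)
  also have "\<dots> = E / ((w\<^sup>2 - 1) * H)"
  proof -
    have "w - 1 \<noteq> 0" "w + 1 \<noteq> 0" "H \<noteq> 0" using w H by auto
    then have "(R - w - 1) / H / (w + 1) + (R - w) / ((w - 1) * H)
        = ((R - w - 1) * (w - 1) + (R - w) * (w + 1)) / ((w - 1) * (w + 1) * H)"
      by (simp add: divide_simps)
    moreover have "(R - w - 1) * (w - 1) + (R - w) * (w + 1) = E" "(w - 1) * (w + 1) = w\<^sup>2 - 1"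
      unfolding E_def by algebra+
    ultimately show ?thesis by simp
  qed
  finally have B: "B \<le> E / ((w\<^sup>2 - 1) * H)" .
  \<comment> \<open>\<open>\<alpha> * H + \<beta>\<close> is the difference of the sides of
    \<open>key\<close> with \<open>k = H - g\<close>. As \<open>\<beta>\<close> is nonnegative, only
    negative \<open>\<alpha>\<close> needs work; there \<open>\<sigma>0\<close> bounds
    \<open>H\<close> from above.\<close>
  define \<alpha> where "\<alpha> = (w\<^sup>2 - 1) * (8 * (R - 1) * w + 4 * R + 8 * w) - 4 * w * (R - 1) * E"
  define \<beta> where "\<beta> = E * w * (g * (4 * R - 4 * w + 2) - (R - 1) * (R - 2 * w + 4))"
  have "(R - 1) * (R - 2 * w + 4) \<le> (R - 1) * (4 * R - 4 * w + 2)"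
    using R w by (intro mult_left_mono) auto
  also have "\<dots> \<le> g * (4 * R - 4 * w + 2)"
    using g R w by (intro mult_right_mono) auto
  finally have \<beta>: "\<beta> \<ge> 0"
    using E w by (simp add: \<beta>_def)
  have "\<alpha> * H + \<beta> \<ge> 0"
  proof (cases "\<alpha> \<ge> 0")
    case True
    then show ?thesis using \<beta> H by simp
  next
    case False
    then have "2 * w < R"
      using crossing_poly_le_1[of w R] R by (force simp: \<alpha>_def E_def)
    note R1 = R1[OF this]
    define \<Delta> where "\<Delta> = (R - 1) * (R - 2 * w)"
    have \<Delta>: "\<Delta> > 0" using R1 w by (simp add: \<Delta>_def)
    have "\<Delta> * H = g * (R - w) * (R - w - 1) + ((R - 1) * (R - 2 * w) * k - g * w * (w - 1))"
      unfolding H_def \<Delta>_def by algebra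
    then have "\<Delta> * H \<le> g * (R - w) * (R - w - 1)"
      using \<sigma>0 by linarith
    then have "\<alpha> * (g * (R - w) * (R - w - 1)) \<le> \<alpha> * (\<Delta> * H)"
      using False by (intro mult_left_mono_neg) auto
    \<comment> \<open>\<open>crossing_poly_le_2\<close> is applied with \<open>2 * g\<close> in
      place of \<open>g\<close>, matching \<open>g2\<close>; the factor 2 cancels.\<close>
    moreover have "\<alpha> * (2 * g) * (R - w) * (R - w - 1) + E * w * ((2 * g) * (4 * R - 4 * w + 2)
        - 2 * (R - 1) * (R - 2 * w + 4)) * ((R - 1) * (R - 2 * w)) \<ge> 0"
      unfolding \<alpha>_def E_def using w R1 g2 by (rule crossing_poly_le_2)
    then have "\<alpha> * (g * (R - w) * (R - w - 1)) + \<beta> * \<Delta> \<ge> 0"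
      unfolding \<beta>_def \<Delta>_def by (simp add: algebra_simps)
    ultimately have "\<Delta> * (\<alpha> * H + \<beta>) \<ge> 0"
      by (simp add: algebra_simps)
    then show ?thesis
      using \<Delta> by (metis not_less mult_pos_neg)
  qed
  also have "\<alpha> * H + \<beta> = (w\<^sup>2 - 1) * H * (8 * (R - 1) * w + 4 * R + 8 * w) - E * l * w"
    unfolding \<alpha>_def \<beta>_def l_def H_def by algebra
  finally have key: "E * l * w \<le> (w\<^sup>2 - 1) * H * (8 * (R - 1) * w + 4 * R + 8 * w)"
    by simp
  have w2: "w\<^sup>2 - 1 > 0"
    using w by (simp add: one_less_power)
  have "B * \<sigma> \<le> 2 * R + 4 * w + 8 * (R - 1) * s"
  proof (cases "\<sigma> \<le> 0")
    case True
    then have "B * \<sigma> \<le> 0" using B0 by (simp add: mult_nonneg_nonpos)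
    moreover have "2 * R + 4 * w + 8 * (R - 1) * s \<ge> 0" using R w s by simp
    ultimately show ?thesis by linarith
  next
    case False
    have "B * \<sigma> \<le> E / ((w\<^sup>2 - 1) * H) * (s * l)"
      using False B \<sigma> B0 by (intro mult_mono) auto
    also have "\<dots> = (s / w) * (E * l * w / ((w\<^sup>2 - 1) * H))"
      using w by simp
    also have "\<dots> \<le> (s / w) * (8 * (R - 1) * w + 4 * R + 8 * w)"
      using key w2 H s w by (intro mult_left_mono) (simp_all add: pos_divide_le_eq mult.commute)
    \<comment> \<open>Since \<open>2 * s \<le> w\<close>, weakening \<open>2 * s / w\<close> to 1
      loses nothing in sign; \<open>key\<close> is the case \<open>s = w / 2\<close>.\<close>
    also have "\<dots> = 8 * (R - 1) * s + (2 * R + 4 * w) * (2 * s / w)"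
      using w by (simp add: field_simps)
    also have "\<dots> \<le> 8 * (R - 1) * s + (2 * R + 4 * w) * 1"
      using s w R by (intro add_left_mono mult_left_mono) auto
    finally show ?thesis by simp
  qed
  then show ?thesis by (simp add: B_def \<sigma>_def H_def)
qed

section \<open>At most one sign change along a chain\<close>

text \<open>
  The weights \<open>\<omega> s\<close> are hypergeometric, \<open>\<sigma> s * \<omega> s = \<tau> (s - 1) * \<omega> (s - 1) - \<tau> s * \<omega> s\<close>, so sums of
  \<open>\<sigma> s * \<omega> s\<close> and of \<open>s * \<sigma> s * \<omega> s - \<tau> s * \<omega> s\<close> telescope to boundary terms. Eliminating the boundary
  terms of \<open>\<Lambda>\<close> with these identities makes every summand have the required sign; the sign
  of \<open>\<sigma> 0\<close> decides which alternative holds.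
\<close>

lemma \<Lambda>_crossing:
  fixes q g W :: nat and w :: int
  assumes w: "1 \<le> w" "w \<le> int q" and g: "q + 1 \<le> g" "q * (q - 1) + 2 \<le> 2 * g"
  shows "\<Lambda> (q + 2) g (Suc W) w \<ge> 0 \<or> \<Lambda> (q + 2) g W (w + 2) \<le> \<Lambda> (q + 2) g (Suc W) w"
proof (cases "w = 1")
  case True
  then show ?thesis
    by (simp add: \<Lambda>_def ibinom_neg ibinom_nonneg real_c_nonneg)
next
  case False
  define x where "x = real_of_int w"
  define R where "R = real q + 2"
  define G where "G = real g"
  define k where "k = real W + 1"
  define M where "M = nat (w + 2)"
  define v where "v s = x - 2 * real s" for s
  define \<omega> where "\<omega> s = ibinom (q + 2) (w - 2 * int s) * real_c g (Suc W + s)" for s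
  \<comment> \<open>This is the weight \<open>\<omega>\<close> continued to index -1.\<close>
  define \<omega>u where "\<omega>u = ibinom (q + 2) (w + 2) * real_c g W"
  define \<tau> where "\<tau> s = v s * (v s - 1) * (G + k + real s)" for s
  define \<sigma> where "\<sigma> s = (R - v s) * (R - v s - 1) * (k + real s) - \<tau> s" for s
  have x: "2 \<le> x" "x + 2 \<le> R" using False w by (auto simp: x_def R_def)
  have R1: "2 * x + 1 \<le> R" if "2 * x < R"
  proof -
    have "real_of_int (2 * w) < real_of_int (int q + 2)" using that by (simp add: x_def R_def)
    then have "2 * w + 1 \<le> int q + 2" by (simp only: of_int_less_iff)
    then have "real_of_int (2 * w + 1) \<le> real_of_int (int q + 2)" by (simp only: of_int_le_iff)
    then show ?thesis by (simp add: x_def R_def)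
  qed
  have G: "R - 1 \<le> G" using g by (simp add: R_def G_def)
  have "real (q * (q - 1) + 2) \<le> real (2 * g)" using g(2) by (simp only: of_nat_le_iff)
  moreover have "real (q - 1) = real q - 1" using w by simp
  ultimately have G2: "(R - 2) * (R - 3) + 2 \<le> 2 * G" by (simp add: R_def G_def)
  have k: "1 \<le> k" by (simp add: k_def)
  have \<omega>_nonneg: "\<omega> s \<ge> 0" for s
    by (simp add: \<omega>_def ibinom_nonneg real_c_nonneg)
  have \<omega>_0: "\<omega> s = 0" if "w < 2 * int s" for s
    using that by (simp add: \<omega>_def ibinom_neg)
  have ibinom_step: "(R - of_int (j - 2)) * (R - of_int (j - 2) - 1) * ibinom (q + 2) (j - 2)
    = of_int j * (of_int j - 1) * ibinom (q + 2) j" for j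
    using ibinom_two_steps(1)[of j q] ibinom_two_steps(3)[of q "j - 2"] by (simp add: R_def)
  have \<sigma>\<omega>: "\<sigma> (Suc s) * \<omega> (Suc s) = \<tau> s * \<omega> s - \<tau> (Suc s) * \<omega> (Suc s)" for s
  proof -
    define b b' c c' where "b = ibinom (q + 2) (w - 2 * int s)"
      and "b' = ibinom (q + 2) (w - 2 * int (Suc s))"
      and "c = real_c g (Suc W + s)" and "c' = real_c g (Suc W + Suc s)"
    have "(R - v (Suc s)) * (R - v (Suc s) - 1) * b' = v s * (v s - 1) * b"
      using ibinom_step[of "w - 2 * int s"] by (simp add: v_def x_def b_def b'_def algebra_simps)
    moreover have "(k + real (Suc s)) * c' = (G + k + real s) * c"
      using real_c_rec[of "Suc W + s" g] by (simp add: k_def G_def c_def c'_def algebra_simps)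
    moreover have "\<omega> s = b * c" "\<omega> (Suc s) = b' * c'"
      by (simp_all add: \<omega>_def b_def b'_def c_def c'_def)
    ultimately show ?thesis
      unfolding \<sigma>_def \<tau>_def by algebra
  qed
  have \<sigma>\<omega>0: "\<sigma> 0 * \<omega> 0 = (x + 2) * (x + 1) * (G + k - 1) * \<omega>u - \<tau> 0 * \<omega> 0"
  proof -
    define b b' c c' where "b = ibinom (q + 2) (w + 2)" and "b' = ibinom (q + 2) w"
      and "c = real_c g W" and "c' = real_c g (Suc W)"
    have "(R - v 0) * (R - v 0 - 1) * b' = (x + 2) * (x + 1) * b"
      using ibinom_step[of "w + 2"] by (simp add: v_def x_def b_def b'_def algebra_simps)
    moreover have "(k + real 0) * c' = (G + k - 1) * c"
      using real_c_rec[of W g] by (simp add: k_def G_def c_def c'_def algebra_simps)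
    moreover have "\<omega>u = b * c" "\<omega> 0 = b' * c'"
      by (simp_all add: \<omega>_def \<omega>u_def b_def b'_def c_def c'_def)
    ultimately show ?thesis
      unfolding \<sigma>_def \<tau>_def by algebra
  qed
  \<comment> \<open>The weights vanish past the support, so telescoping leaves only the boundary
    terms at index 0.\<close>
  have end0: "\<omega> (Suc N) = 0" if "M \<le> N" for N
    by (rule \<omega>_0) (use that w in \<open>simp add: M_def\<close>)
  have tel0: "(\<Sum>s\<le>N. \<sigma> (Suc s) * \<omega> (Suc s)) = \<tau> 0 * \<omega> 0 - \<tau> (Suc N) * \<omega> (Suc N)" for N
    by (induction N) (simp_all add: \<sigma>\<omega>)
  have tel1: "(\<Sum>s\<le>N. real (Suc s) * (\<sigma> (Suc s) * \<omega> (Suc s)) - \<tau> (Suc s) * \<omega> (Suc s))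
      = \<tau> 0 * \<omega> 0 - real (N + 2) * (\<tau> (Suc N) * \<omega> (Suc N))" for N
    unfolding \<sigma>\<omega> by (induction N) (simp_all add: algebra_simps)
  have \<Lambda>w: "\<Lambda> (q + 2) g (Suc W) w = x * (R - x) * \<omega> 0
      + (\<Sum>s\<le>M. \<phi> (q + 2) w (w - 2 - 2 * int s) * \<omega> (Suc s))"
    by (subst \<Lambda>_eq[where M = M])
       (simp_all add: M_def \<omega>_def x_def R_def algebra_simps)
  have "\<Lambda> (q + 2) g W (w + 2) = (x + 2) * (R - x - 2) * \<omega>u
      + (\<Sum>s\<le>Suc M. \<phi> (q + 2) (w + 2) (w - 2 * int s) * \<omega> s)"
    by (subst \<Lambda>_eq[where M = "Suc M"])
       (simp_all add: M_def \<omega>_def \<omega>u_def x_def R_def algebra_simps)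
  also have "(\<Sum>s\<le>Suc M. \<phi> (q + 2) (w + 2) (w - 2 * int s) * \<omega> s)
      = \<phi> (q + 2) (w + 2) w * \<omega> 0
        + (\<Sum>s\<le>M. \<phi> (q + 2) (w + 2) (w - 2 - 2 * int s) * \<omega> (Suc s))"
    by (subst sum.atMost_Suc_shift) (simp add: algebra_simps)
  finally have \<Lambda>u: "\<Lambda> (q + 2) g W (w + 2) = (x + 2) * (R - x - 2) * \<omega>u
      + (\<phi> (q + 2) (w + 2) w * \<omega> 0
        + (\<Sum>s\<le>M. \<phi> (q + 2) (w + 2) (w - 2 - 2 * int s) * \<omega> (Suc s)))" .
  show ?thesis
  proof (cases "(R - 1) * (R - 2 * x) * k \<ge> G * x * (x - 1)")
    case True
    define P where "P = (x - 1) * (G + k)"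
    have P: "P > 0" unfolding P_def using x G k by simp
    define X where "X s = P * (x * (R - x) - s * (R - 2 * x) - 2 * R * s\<^sup>2)
      + (R - x) * ((s - 1/2) * ((R - (x - 2 * s)) * (R - (x - 2 * s) - 1) * (k + s)
        - (x - 2 * s) * ((x - 2 * s) - 1) * (G + k + s))
        - (x - 2 * s) * ((x - 2 * s) - 1) * (G + k + s))" for s
    have "X (real (Suc s)) * \<omega> (Suc s) \<ge> 0" for s
    proof (cases "w < 2 * int (Suc s)")
      case True
      then show ?thesis using \<omega>_0 by simp
    next
      case False
      then have "2 * real (Suc s) \<le> x" unfolding x_def by linarith
      then have "X (real (Suc s)) \<ge> 0"
        unfolding X_def P_def using True x G k R1
        by (intro crossing_term_nonneg) auto
      then show ?thesis using \<omega>_nonneg by simp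
    qed
    then have "0 \<le> (\<Sum>s\<le>M. 2 * (X (real (Suc s)) * \<omega> (Suc s)))"
      by (intro sum_nonneg) simp
    \<comment> \<open>The multiples \<open>2 * (R - x)\<close> and \<open>- (R - x)\<close> of the
      two telescoping sums leave \<open>(R - x) * (\<tau> 0 * \<omega> 0)\<close>, which is
      \<open>P\<close> times the boundary term of \<open>\<Lambda>\<close>.\<close>
    also have "\<dots> = (\<Sum>s\<le>M. P * (\<phi> (q + 2) w (w - 2 - 2 * int s) * \<omega> (Suc s))
        + (2 * (R - x) * (real (Suc s) * (\<sigma> (Suc s) * \<omega> (Suc s)) - \<tau> (Suc s) * \<omega> (Suc s))
          - (R - x) * (\<sigma> (Suc s) * \<omega> (Suc s))))"
    proof (rule sum.cong)
      fix s
      have \<phi>: "\<phi> (q + 2) w (w - 2 - 2 * int s)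
          = 2 * (x * (R - x) - real (Suc s) * (R - 2 * x) - 2 * R * (real (Suc s))\<^sup>2)"
        by (simp add: \<phi>_def x_def R_def algebra_simps power2_eq_square)
      have X: "X (real (Suc s)) = P * (x * (R - x) - real (Suc s) * (R - 2 * x) - 2 * R * (real (Suc s))\<^sup>2)
          + (R - x) * ((real (Suc s) - 1/2) * \<sigma> (Suc s) - \<tau> (Suc s))"
        by (simp add: X_def \<sigma>_def \<tau>_def v_def)
      show "2 * (X (real (Suc s)) * \<omega> (Suc s)) = P * (\<phi> (q + 2) w (w - 2 - 2 * int s) * \<omega> (Suc s))
        + (2 * (R - x) * (real (Suc s) * (\<sigma> (Suc s) * \<omega> (Suc s)) - \<tau> (Suc s) * \<omega> (Suc s))
          - (R - x) * (\<sigma> (Suc s) * \<omega> (Suc s)))"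
        unfolding X \<phi> by algebra
    qed simp
    also have "\<dots> = P * (\<Sum>s\<le>M. \<phi> (q + 2) w (w - 2 - 2 * int s) * \<omega> (Suc s))
        + (2 * (R - x) * (\<tau> 0 * \<omega> 0) - (R - x) * (\<tau> 0 * \<omega> 0))"
      unfolding sum.distrib sum_subtractf sum_distrib_left[symmetric]
      using tel0[of M] tel1[of M] by (simp add: end0 sum_subtractf)
    also have "\<dots> = P * \<Lambda> (q + 2) g (Suc W) w"
      unfolding \<Lambda>w by (simp add: \<tau>_def v_def P_def algebra_simps)
    finally show ?thesis
      using P by (simp add: zero_le_mult_iff)
  next
    case False
    \<comment> \<open>\<open>B\<close> and \<open>B'\<close> express the boundary terms at
      \<open>\<omega>u\<close> and \<open>\<omega> 0\<close> through
      \<open>\<sigma> 0 * \<omega> 0\<close> and \<open>\<tau> 0 * \<omega> 0\<close>.\<close>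
    define B where "B = (R - x - 2) / ((x + 1) * (G + k - 1))"
    define B' where "B' = (R - x) / ((x - 1) * (G + k))"
    have den: "(x + 1) * (G + k - 1) > 0" "(x - 1) * (G + k) > 0"
      using x G k by auto
    have ne: "x + 1 \<noteq> 0" "G + k - 1 \<noteq> 0" "x - 1 \<noteq> 0" "G + k \<noteq> 0"
      using den by auto
    have B0: "B \<ge> 0" using x den by (simp add: B_def)
    have "(x + 2) * (R - x - 2) * \<omega>u = B * ((x + 2) * (x + 1) * (G + k - 1) * \<omega>u)"
      using ne by (simp add: B_def)
    also have "\<dots> = B * (\<sigma> 0 * \<omega> 0) + B * (\<tau> 0 * \<omega> 0)"
      using \<sigma>\<omega>0 by algebra
    finally have u: "(x + 2) * (R - x - 2) * \<omega>u = B * (\<sigma> 0 * \<omega> 0) + B * (\<tau> 0 * \<omega> 0)" .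
    have w0: "x * (R - x) * \<omega> 0 = B' * (\<tau> 0 * \<omega> 0)"
      using ne by (simp add: B'_def \<tau>_def v_def)
    have \<tau>0: "\<tau> 0 * \<omega> 0 = (\<Sum>s\<le>M. \<sigma> (Suc s) * \<omega> (Suc s))"
      using tel0[of M] by (simp add: end0)
    have d\<phi>: "\<phi> (q + 2) (w + 2) (w - 2 - 2 * int s) - \<phi> (q + 2) w (w - 2 - 2 * int s)
        = - (2 * R + 4 * x + 8 * (R - 1) * real (Suc s))" for s
      by (simp add: \<phi>_def x_def R_def algebra_simps power2_eq_square)
    have \<phi>0: "\<phi> (q + 2) (w + 2) w = 2 * (x * (R - x)) - 2 * R - 4 * x"
      by (simp add: \<phi>_def x_def R_def algebra_simps power2_eq_square)
    have "\<Lambda> (q + 2) g W (w + 2) - \<Lambda> (q + 2) g (Suc W) w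
        = (x + 2) * (R - x - 2) * \<omega>u + x * (R - x) * \<omega> 0 - (2 * R + 4 * x) * \<omega> 0
          + (\<Sum>s\<le>M. (\<phi> (q + 2) (w + 2) (w - 2 - 2 * int s) - \<phi> (q + 2) w (w - 2 - 2 * int s))
              * \<omega> (Suc s))"
      unfolding \<Lambda>u \<Lambda>w \<phi>0 by (simp add: algebra_simps sum_subtractf)
    \<comment> \<open>Spreading \<open>\<tau> 0 * \<omega> 0\<close> over the sum gives every
      summand the factor \<open>B + B'\<close> that \<open>crossing_term_le\<close>
      estimates.\<close>
    also have "\<dots> = (B * \<sigma> 0 - (2 * R + 4 * x)) * \<omega> 0
          + (\<Sum>s\<le>M. ((B + B') * \<sigma> (Suc s) - (2 * R + 4 * x + 8 * (R - 1) * real (Suc s))) * \<omega> (Suc s))"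
      unfolding u w0 \<tau>0 d\<phi>
      by (simp add: algebra_simps sum_subtractf sum.distrib sum_distrib_left sum_negf)
    also have "\<dots> \<le> 0"
    proof (rule add_nonpos_nonpos)
      have "\<sigma> 0 = (R - 1) * (R - 2 * x) * k - G * x * (x - 1)"
        unfolding \<sigma>_def \<tau>_def v_def by (simp add: algebra_simps)
      then have "B * \<sigma> 0 \<le> 0"
        using False B0 by (simp add: mult_nonneg_nonpos)
      then show "(B * \<sigma> 0 - (2 * R + 4 * x)) * \<omega> 0 \<le> 0"
        using x \<omega>_nonneg[of 0] by (intro mult_nonpos_nonneg) auto
    next
      show "(\<Sum>s\<le>M. ((B + B') * \<sigma> (Suc s) - (2 * R + 4 * x + 8 * (R - 1) * real (Suc s))) * \<omega> (Suc s)) \<le> 0"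
      proof (rule sum_nonpos)
        fix s
        show "((B + B') * \<sigma> (Suc s) - (2 * R + 4 * x + 8 * (R - 1) * real (Suc s))) * \<omega> (Suc s) \<le> 0"
        proof (cases "w < 2 * int (Suc s)")
          case True
          then show ?thesis using \<omega>_0 by simp
        next
          case le: False
          then have "2 * real (Suc s) \<le> x" unfolding x_def by linarith
          then have "(B + B') * \<sigma> (Suc s) \<le> 2 * R + 4 * x + 8 * (R - 1) * real (Suc s)"
            unfolding \<sigma>_def \<tau>_def v_def B_def B'_def using False x G G2 k R1
            by (intro crossing_term_le) auto
          then show ?thesis using \<omega>_nonneg by (intro mult_nonpos_nonneg) auto
        qed
      qed
    qed
    finally show ?thesis by simp
  qed
qed

section \<open>From the ends of a chain to its interior\<close>

lemma gap_neg: "n < 0 \<Longrightarrow> gap q g W n = 0"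
  by (simp add: gap_def real_T_neg)

lemma gap_mono:
  assumes "\<Lambda> (q + 2) g W (n + 1) \<ge> 0"
  shows "gap q g (Suc W) (n - 2) \<le> gap q g W n"
proof -
  have "0 \<le> (real q + 2)\<^sup>2 * (real q + 2 - 1) * (gap q g W n - gap q g (Suc W) (n - 2))"
    unfolding gap_diff using assms by (simp add: ibinom_nonneg real_c_nonneg)
  moreover have "(real q + 2)\<^sup>2 * (real q + 2 - 1) > 0" by simp
  ultimately have "0 \<le> gap q g W n - gap q g (Suc W) (n - 2)"
    by (metis not_less mult_pos_neg)
  then show ?thesis by simp
qed

text \<open>In the second alternative the binomial in \<open>gap_diff\<close> vanishes, so the two
  defects agree.\<close>

lemma gap_antimono:
  assumes "\<Lambda> (q + 2) g W (n + 1) \<le> 0 \<or> int (q + 2) < n + 1"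
  shows "gap q g W n \<le> gap q g (Suc W) (n - 2)"
proof -
  have "real_c g W * ibinom (q + 2) (n + 1) * \<Lambda> (q + 2) g W (n + 1) \<le> 0"
    using assms
  proof
    assume "int (q + 2) < n + 1"
    then show ?thesis by (simp add: ibinom_gt)
  qed (simp add: mult_nonneg_nonpos ibinom_nonneg real_c_nonneg)
  then have "(real q + 2)\<^sup>2 * (real q + 2 - 1) * (gap q g W n - gap q g (Suc W) (n - 2)) \<le> 0"
    by (simp only: gap_diff)
  moreover have "(real q + 2)\<^sup>2 * (real q + 2 - 1) > 0" by simp
  ultimately have "gap q g W n - gap q g (Suc W) (n - 2) \<le> 0"
    by (metis not_less mult_pos_pos)
  then show ?thesis by simp
qed

text \<open>Either alternative of \<open>\<Lambda>_crossing\<close> carries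
  \<open>\<Lambda> \<ge> 0\<close> to the next larger \<open>W\<close>. So the defect decreases
  along the rest of the chain, down to 0 where the index turns negative.\<close>

lemma gap_nonneg_of_\<Lambda>_nonneg:
  assumes g: "q + 1 \<le> g" "q * (q - 1) + 2 \<le> 2 * g"
  shows "\<Lambda> (q + 2) g W (n + 1) \<ge> 0 \<Longrightarrow> n \<le> int q + 1 \<Longrightarrow> gap q g W n \<ge> 0"
proof (induction "nat n" arbitrary: W n rule: less_induct)
  case less
  have "gap q g (Suc W) (n - 2) \<ge> 0"
  proof (cases "n \<ge> 2")
    case True
    have n: "n - 1 + 2 = n + 1" by simp
    have "\<Lambda> (q + 2) g (Suc W) (n - 1) \<ge> 0
        \<or> \<Lambda> (q + 2) g W (n + 1) \<le> \<Lambda> (q + 2) g (Suc W) (n - 1)"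
      by (rule \<Lambda>_crossing[of "n - 1" q g W, unfolded n]) (use True less.prems g in auto)
    then have "\<Lambda> (q + 2) g (Suc W) (n - 1) \<ge> 0"
      using less.prems by linarith
    then show ?thesis
      using less.hyps[of "n - 2" "Suc W"] less.prems True by simp
  qed (simp add: gap_neg)
  then show ?case
    using gap_mono[OF less.prems(1)] by linarith
qed

text \<open>The reverse walk: a negative \<open>\<Lambda>\<close> stays negative towards smaller
  \<open>W\<close> until the index leaves the range of \<open>\<Lambda>_crossing\<close>, where the
  defect is constant. The chain ends at \<open>W = 0\<close>, covered by \<open>D0\<close>.\<close>

lemma gap_nonneg_of_\<Lambda>_neg:
  assumes g: "q + 1 \<le> g" "q * (q - 1) + 2 \<le> 2 * g" and D0: "\<And>n. n \<ge> 0 \<Longrightarrow> gap q g 0 n \<ge> 0"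
  shows "\<Lambda> (q + 2) g W (n + 1) < 0 \<or> int q + 1 < n \<Longrightarrow> n \<ge> 0 \<Longrightarrow> gap q g W n \<ge> 0"
proof (induction W arbitrary: n)
  case 0
  then show ?case by (simp add: D0)
next
  case (Suc W)
  have *: "\<Lambda> (q + 2) g W (n + 3) < 0 \<or> int q + 1 < n + 2"
    using \<Lambda>_crossing[of "n + 1" q g W] Suc.prems g by (force simp: add.assoc)
  then have "gap q g W (n + 2) \<ge> 0"
    using Suc.IH[of "n + 2"] Suc.prems by (simp add: add.assoc)
  moreover have "gap q g W (n + 2) \<le> gap q g (Suc W) (n + 2 - 2)"
    using * by (intro gap_antimono) (auto simp: add.assoc)
  ultimately show ?case by simp
qed

text \<open>The first and last bounds on \<open>g\<close> say binom(q,2) < g \<le> binom(q+1,2). The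
  middle two exclude the pair \<open>q = 2\<close>, \<open>g = 2\<close>, treated
  separately.\<close>

lemma gap_nonneg_main:
  assumes q: "q \<ge> 2" and g: "2 * g \<le> q * (q + 1)" "2 * g \<ge> q + 4"
    "q + 1 \<le> g" "q * (q - 1) + 2 \<le> 2 * g"
  shows "gap q g W n \<ge> 0"
proof (cases "n \<ge> 0")
  case True
  have "gap q g 0 n \<ge> 0" if "n \<ge> 0" for n
    using that gap_W_0_nonneg[OF q g(1,2)] nonneg_int_cases by metis
  then show ?thesis
    using gap_nonneg_of_\<Lambda>_nonneg[OF g(3,4), of W n] gap_nonneg_of_\<Lambda>_neg[OF g(3,4), of W n] True
    by force
qed (simp add: gap_neg)

section \<open>Small parameters and induction on q\<close>

text \<open>For \<open>g = 0\<close> only \<open>c_0\<close> is nonzero, so this is log-concavity of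
  a binomial row, or trivial for \<open>W > 0\<close>.\<close>

lemma gap_g_0_nonneg: "gap q 0 W n \<ge> 0"
proof -
  have c: "real_c 0 j = (if j = 0 then 1 else 0)" for j
    by (simp add: real_c_def c_eq)
  have real_T: "real_T q 0 W n = (if W = 0 then ibinom q n else 0)" for n
    unfolding real_T_def by (simp add: c if_distrib cong: if_cong)
  have "ibinom q (n - 1) * ibinom q (n + 1) \<le> (ibinom q n)\<^sup>2"
  proof (cases "0 \<le> n \<and> n \<le> int q")
    case True
    define x where "x = real_of_int n"
    have x: "0 \<le> x" "x \<le> real q" using True by (simp_all add: x_def)
    have "(x + 1) * ibinom q (n + 1) = (real q - x) * ibinom q n"
      "x * ibinom q n = (real q - x + 1) * ibinom q (n - 1)"
      using ibinom_rec[of n q] ibinom_rec[of "n - 1" q] by (simp_all add: x_def algebra_simps)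
    then have "(x + 1) * (real q - x + 1) * (ibinom q (n - 1) * ibinom q (n + 1))
        = x * (real q - x) * (ibinom q n)\<^sup>2"
      by algebra
    also have "\<dots> \<le> ((x + 1) * (real q - x + 1)) * (ibinom q n)\<^sup>2"
      using x by (intro mult_right_mono mult_mono) auto
    finally show ?thesis
      using x by (simp add: mult_le_cancel_left)
  qed (auto simp: ibinom_neg ibinom_gt)
  then show ?thesis by (simp add: gap_def real_T)
qed

lemma real_T_1_1: "real_T 1 1 W (int m) = 1"
proof (induction m arbitrary: W rule: less_induct)
  case (less m)
  have "real_c 1 j = 1" for j by (simp add: real_c_def c_eq)
  then show ?case
    using less.IH[of "m - 2" "Suc W"] real_T_shift[of 1 1 W "int m"]
    by (cases "m \<ge> 2") (auto simp: ibinom_gt real_T_neg ibinom_of_nat of_nat_diff not_le less_2_cases_iff)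
qed

text \<open>Only the binomials 1, 2, 1 occur, against the linear \<open>real_c 2\<close>. At
  \<open>m = 0\<close> the single term \<open>real_c 2 W\<close> breaks the pattern.\<close>

lemma real_T_2_2: "real_T 2 2 W (int m) = (if m = 0 then real W + 1 else real m + 1 + 2 * real W)"
proof (induction m arbitrary: W rule: less_induct)
  case (less m)
  have c: "real_c 2 j = real j + 1" for j by (simp add: real_c_def c_eq)
  consider "m = 0" | "m = 1" | "m = 2" | "m \<ge> 3" by linarith
  then show ?case
    using less.IH[of "m - 2" "Suc W"] real_T_shift[of 2 2 W "int m"]
    by cases (auto simp: ibinom_gt real_T_neg ibinom_def c of_nat_diff)
qed

text \<open>Induction on \<open>q\<close>: a \<open>g\<close> admissible for \<open>q\<close> is
  inherited by \<open>gap_nonneg_Suc\<close>, and the new values of \<open>g\<close> fall to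
  \<open>gap_nonneg_main\<close> or to explicit formulas.\<close>

lemma gap_nonneg:
  assumes "g \<le> (q + 1) choose 2"
  shows "gap q g W n \<ge> 0"
  using assms
proof (induction q arbitrary: n)
  case 0
  then show ?case by (simp add: gap_g_0_nonneg binomial_eq_0)
next
  case (Suc q)
  have ch: "2 * ((j + 1) choose 2) = j * (j + 1)" for j :: nat
    by (simp add: choose_two)
  consider "n < 0" | "g = 0" | "n \<ge> 0" "g \<ge> 1" "g \<le> (q + 1) choose 2"
    | "n \<ge> 0" "g \<ge> 1" "g > (q + 1) choose 2" by linarith
  then show ?case
  proof cases
    case 3
    then have "q \<noteq> 0" by (cases q) (auto simp: binomial_eq_0)
    then show ?thesis
      using 3 Suc.IH by (intro gap_nonneg_Suc) auto
  next
    case 4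
    obtain m where n: "n = int m" using 4 nonneg_int_cases by blast
    have g: "q * (q + 1) + 2 \<le> 2 * g" "2 * g \<le> Suc q * (Suc q + 1)"
      using 4 ch[of q] ch[of "Suc q"] Suc.prems by linarith+
    have "g = 2 \<or> g = 3" if "q = 1"
      using g that by auto
    \<comment> \<open>In terms of \<open>Suc q\<close>, the pairs (1,1) and (2,2) lie outside
      \<open>gap_nonneg_main\<close>; (2,3) and all larger cases satisfy its bounds.\<close>
    then consider "q = 0" | "q = 1" "g = 2" | "q = 1" "g = 3" | "q \<ge> 2"
      by linarith
    then show ?thesis
    proof cases
      case 1
      then have "g = 1" using g by auto
      have "n + 1 = int (m + 1)" using n by simp
      then have "real_T 1 1 W (n + 1) = 1" by (simp only: real_T_1_1)
      moreover have "real_T 1 1 W (n - 1) \<le> 1"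
        using real_T_1_1[of W "m - 1"] n by (cases m) (auto simp: real_T_neg)
      moreover have "real_T 1 1 W n = 1" by (simp only: n real_T_1_1)
      ultimately show ?thesis
        using 1 \<open>g = 1\<close> by (simp add: gap_def)
    next
      case 2
      have "n + 1 = int (m + 1)" using n by simp
      then have S1: "real_T 2 2 W (n + 1) = real m + 2 + 2 * real W"
        by (simp only: real_T_2_2) simp
      have S0: "real_T 2 2 W n = (if m = 0 then real W + 1 else real m + 1 + 2 * real W)"
        by (simp only: n real_T_2_2)
      consider "m = 0" | "m = 1" | "m \<ge> 2" by linarith
      then have "gap 2 2 W n \<ge> 0"
      proof cases
        case 3
        then have "n - 1 = int (m - 1)" using n by simp
        then have "real_T 2 2 W (n - 1) = real m + 2 * real W"
          using 3 by (simp only: real_T_2_2) (simp add: of_nat_diff)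
        then show ?thesis
          using 3 S0 S1 by (simp add: gap_def power2_eq_square algebra_simps)
      next
        case 2
        then have "real_T 2 2 W (n - 1) = real W + 1"
          using real_T_2_2[of W 0] n by simp
        then show ?thesis
          using 2 S0 S1 by (simp add: gap_def power2_eq_square algebra_simps)
      qed (simp add: gap_def real_T_neg n)
      then show ?thesis using 2 by (simp add: numeral_2_eq_2)
    next
      case 3
      then show ?thesis by (intro gap_nonneg_main) auto
    next
      case 4
      have "2 * (q + 1) \<le> q * (q + 1)" using 4 by (intro mult_right_mono) auto
      then show ?thesis
        using 4 g by (intro gap_nonneg_main) auto
    qed
  qed (auto simp: gap_neg gap_g_0_nonneg)
qed

section \<open>Equivalence of the two conditions\<close>

theorem theorem2p4:
  fixes q g :: nat
  shows "g \<le> (q + 1) choose 2 \<longleftrightarrow>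
    (\<forall>W m :: nat. 1 \<le> m \<longrightarrow> (T q g m W)\<^sup>2 \<ge> T q g (m - 1) W * T q g (m + 1) W)"
proof
  assume g: "g \<le> (q + 1) choose 2"
  show "\<forall>W m. 1 \<le> m \<longrightarrow> (T q g m W)\<^sup>2 \<ge> T q g (m - 1) W * T q g (m + 1) W"
  proof (intro allI impI)
    fix W m :: nat
    assume m: "1 \<le> m"
    have "real_T q g W (int m - 1) = of_int (T q g (m - 1) W)" "real_T q g W (int m + 1) = of_int (T q g (m + 1) W)"
      using m real_T_of_nat[of q g W "m - 1"] real_T_of_nat[of q g W "m + 1"] by (simp_all add: of_nat_diff add.commute)
    then have "real_of_int (T q g (m - 1) W * T q g (m + 1) W) \<le> real_of_int ((T q g m W)\<^sup>2)"
      using gap_nonneg[OF g, of W "int m"] by (simp add: gap_def real_T_of_nat)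
    then show "T q g (m - 1) W * T q g (m + 1) W \<le> (T q g m W)\<^sup>2"
      by (simp only: of_int_le_iff)
  qed
next
  assume "\<forall>W m :: nat. 1 \<le> m \<longrightarrow> (T q g m W)\<^sup>2 \<ge> T q g (m - 1) W * T q g (m + 1) W"
  then have "T q g (1 - 1) 0 * T q g (1 + 1) 0 \<le> (T q g 1 0)\<^sup>2"
    by blast
  then have T: "T q g 0 0 * T q g 2 0 \<le> (T q g 1 0)\<^sup>2"
    by (simp only: diff_self_eq_0 one_add_one)
  have sets: "{r :: nat. 2 * r \<le> 0} = {0}" "{r :: nat. 2 * r \<le> 1} = {0}" "{r :: nat. 2 * r \<le> 2} = {0, 1}"
    by auto
  \<comment> \<open>At \<open>W = 0\<close> the values for \<open>m\<close> = 0, 1, 2 are 1,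
    \<open>q\<close> and binom(q,2) + g.\<close>
  have "int (q choose 2) + int g \<le> (int q)\<^sup>2"
    using T unfolding T_def sets by (simp add: c_eq split: if_splits)
  then have "(q choose 2) + g \<le> q * q"
    by (simp add: power2_eq_square flip: of_nat_add of_nat_mult)
  moreover have "(q choose 2) + ((q + 1) choose 2) = q * q"
  proof -
    have "2 * (q choose 2) = q * (q - 1)" "2 * ((q + 1) choose 2) = q * (q + 1)"
      by (cases q; simp add: choose_two)+
    then have "2 * ((q choose 2) + ((q + 1) choose 2)) = 2 * (q * q)"
      by (cases q) (simp_all add: algebra_simps)
    then show ?thesis by simp
  qed
  ultimately show "g \<le> (q + 1) choose 2" by linarith
qed

end
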